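(* Let $D>0$ be a non-square discriminant. For every integral form $q$ of discriminant $D$, the sequence obtained from $q$ by the simple reduction algorithm described in the context becomes periodic, and its cycle consists of simply reduced forms equivalent to $q$; thus every form of discriminant $D$ is explicitly equivalent to a cycle of simply reduced forms. Two forms of discriminant $D$ are equivalent if and only if their cycles of simply reduced forms agree.
   Context: Forms $[a,b,c]=ax^2+bxy+cy^2$ have integer coefficients, discriminant $D=b^2-4ac$ (here $D>0$ not a square, so $a,c\ne0$). For $M=\begin{pmatrix}\alpha&\beta\\\gamma&\delta\end{pmatrix}$, $q|M(x,y):=q(\alpha x+\beta y,\gamma x+\delta y)$; $q_1\sim q_2$ if $q_1=q_2|M$ for some $M\in\mathrm{SL}(2,\mathbb{Z})$. $L=\begin{pmatrix}1&1\\0&1\end{pmatrix}$, $R=\begin{pmatrix}1&0\\1&1\end{pmatrix}$. For $q=[a,b,c]$ define $M_L(q)=L^k$ with $k=\lfloor\frac{-b+\sqrt D}{2a}\rfloor$ and $M_R(q)=R^k$ with $k=\lfloor-\frac{b+\sqrt D}{2c}\rfloor$. A form $[a,b,c]$ is simply reduced if $a>0>c$ and $|a+c|<|b|$. Simple reduction algorithm: starting from $q$, apply alternately $q\mapsto q|M_L(q)$, $q\mapsto q|M_R(q)$, $q\mapsto q|M_L(q)$, etc., and stop when the resulting sequence becomes periodic; the output is the cycle (periodic part) of forms. *)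

theory Defs
  imports "HOL-Analysis.Determinants"
begin

datatype bqf = Form (coeff_a: int) (coeff_b: int) (coeff_c: int)

fun bqf_eval :: "bqf \<Rightarrow> int \<Rightarrow> int \<Rightarrow> int" where
  "bqf_eval (Form a b c) x y = a * x^2 + b * x * y + c * y^2"

fun disc :: "bqf \<Rightarrow> int" where
  "disc (Form a b c) = b^2 - 4 * a * c"

text \<open>The form \<open>q|M\<close>, given by the coefficients of the substituted polynomial; see
  \<open>bqf_eval_act\<close> below. The lemma \<open>bqf_eqI\<close> shows that a form is determined by its values.\<close>

fun act :: "bqf \<Rightarrow> int^2^2 \<Rightarrow> bqf" where
  "act (Form a b c) M =
     Form (bqf_eval (Form a b c) (M$1$1) (M$2$1))
          (2 * a * (M$1$1) * (M$1$2) + b * ((M$1$1) * (M$2$2) + (M$1$2) * (M$2$1))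
             + 2 * c * (M$2$1) * (M$2$2))
          (bqf_eval (Form a b c) (M$1$2) (M$2$2))"

lemma bqf_eval_act:
  "bqf_eval (act q M) x y = bqf_eval q (M$1$1 * x + M$1$2 * y) (M$2$1 * x + M$2$2 * y)"
  by (cases q) (simp add: algebra_simps power2_eq_square)

lemma bqf_eqI:
  assumes "\<And>x y. bqf_eval q x y = bqf_eval q' x y"
  shows "q = q'"
  using assms[of 1 0] assms[of 0 1] assms[of 1 1] by (cases q; cases q') simp

definition bqf_equiv :: "bqf \<Rightarrow> bqf \<Rightarrow> bool" where
  "bqf_equiv q1 q2 \<longleftrightarrow> (\<exists>M :: int^2^2. det M = 1 \<and> q1 = act q2 M)"

definition L_mat :: "int^2^2" where
  "L_mat = vector [vector [1, 1], vector [0, 1]]"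

definition R_mat :: "int^2^2" where
  "R_mat = vector [vector [1, 0], vector [1, 1]]"

text \<open>Integer powers with respect to the matrix product \<open>**\<close>. (The class operations \<open>*\<close> and
  \<open>^\<close> on vector types are componentwise.)\<close>

definition mat_zpow :: "int^2^2 \<Rightarrow> int \<Rightarrow> int^2^2" where
  "mat_zpow M k =
     (if k \<ge> 0 then (((**) M) ^^ nat k) (mat 1) else (((**) (matrix_inv M)) ^^ nat (- k)) (mat 1))"

fun M_L :: "bqf \<Rightarrow> int^2^2" where
  "M_L (Form a b c) =
     mat_zpow L_mat \<lfloor>(- real_of_int b + sqrt (real_of_int (disc (Form a b c)))) / (2 * real_of_int a)\<rfloor>"

fun M_R :: "bqf \<Rightarrow> int^2^2" where
  "M_R (Form a b c) =
     mat_zpow R_mat \<lfloor>- ((real_of_int b + sqrt (real_of_int (disc (Form a b c)))) / (2 * real_of_int c))\<rfloor>"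

fun simply_reduced :: "bqf \<Rightarrow> bool" where
  "simply_reduced (Form a b c) \<longleftrightarrow> a > 0 \<and> 0 > c \<and> \<bar>a + c\<bar> < \<bar>b\<bar>"

definition step_mat :: "nat \<Rightarrow> bqf \<Rightarrow> int^2^2" where
  "step_mat n q = (if even n then M_L q else M_R q)"

fun reduction_seq :: "bqf \<Rightarrow> nat \<Rightarrow> bqf" where
  "reduction_seq q 0 = q"
| "reduction_seq q (Suc n) = act (reduction_seq q n) (step_mat n (reduction_seq q n))"

text \<open>The product of the first \<open>n\<close> matrices used by the algorithm: the explicit matrix carrying
  \<open>q\<close> to its \<open>n\<close>-th iterate.\<close>

fun reduction_mat :: "bqf \<Rightarrow> nat \<Rightarrow> int^2^2" where
  "reduction_mat q 0 = mat 1"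
| "reduction_mat q (Suc n) = reduction_mat q n ** step_mat n (reduction_seq q n)"

definition periodic_from :: "(nat \<Rightarrow> 'a) \<Rightarrow> nat \<Rightarrow> nat \<Rightarrow> bool" where
  "periodic_from s N p \<longleftrightarrow> p > 0 \<and> (\<forall>n\<ge>N. s (n + p) = s n)"

definition becomes_periodic :: "(nat \<Rightarrow> 'a) \<Rightarrow> bool" where
  "becomes_periodic s \<longleftrightarrow> (\<exists>N p. periodic_from s N p)"

definition preperiod :: "(nat \<Rightarrow> 'a) \<Rightarrow> nat" where
  "preperiod s = (LEAST N. \<exists>p. periodic_from s N p)"

definition period :: "(nat \<Rightarrow> 'a) \<Rightarrow> nat" where
  "period s = (LEAST p. periodic_from s (preperiod s) p)"

text \<open>One full minimal period, starting at the first index from which the sequence is periodic.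
  It is meaningful for sequences that become periodic, and is then nonempty.\<close>

definition periodic_part :: "(nat \<Rightarrow> 'a) \<Rightarrow> 'a list" where
  "periodic_part s = map s [preperiod s ..< preperiod s + period s]"

definition simple_cycle :: "bqf \<Rightarrow> bqf list" where
  "simple_cycle q = periodic_part (reduction_seq q)"

text \<open>A cycle has no distinguished first member, so two cycles agree if they are equal as
  cyclically ordered lists.\<close>

definition cycles_agree :: "'a list \<Rightarrow> 'a list \<Rightarrow> bool" where
  "cycles_agree xs ys \<longleftrightarrow> (\<exists>k. ys = rotate k xs)"

lemma matrix_2_eqI:
  fixes A B :: "int^2^2"
  assumes "A$1$1 = B$1$1" "A$1$2 = B$1$2" "A$2$1 = B$2$1" "A$2$2 = B$2$2"
  shows "A = B"
  using assms by (simp add: vec_eq_iff forall_2)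

lemma matrix_inv_eqI:
  fixes A B :: "int^2^2"
  assumes "A ** B = mat 1" "B ** A = mat 1"
  shows "matrix_inv A = B"
proof -
  have *: "A ** matrix_inv A = mat 1 \<and> matrix_inv A ** A = mat 1"
    unfolding matrix_inv_def by (rule someI[of _ B]) (use assms in auto)
  have "matrix_inv A = (B ** A) ** matrix_inv A"
    using assms by simp
  also have "\<dots> = B"
    using * by (simp add: matrix_mul_assoc[symmetric])
  finally show ?thesis .
qed

lemma L_mat_inv: "matrix_inv L_mat = vector [vector [1, -1], vector [0, 1]]"
  by (rule matrix_inv_eqI; rule matrix_2_eqI)
     (simp_all add: L_mat_def matrix_matrix_mult_def sum_2 mat_def)

lemma R_mat_inv: "matrix_inv R_mat = vector [vector [1, 0], vector [-1, 1]]"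
  by (rule matrix_inv_eqI; rule matrix_2_eqI)
     (simp_all add: R_mat_def matrix_matrix_mult_def sum_2 mat_def)

lemma funpow_upper:
  "(((**) (vector [vector [1, t], vector [0, 1]] :: int^2^2)) ^^ n) (mat 1)
     = vector [vector [1, int n * t], vector [0, 1]]"
  by (induction n; rule matrix_2_eqI)
     (simp_all add: matrix_matrix_mult_def sum_2 mat_def algebra_simps)

lemma funpow_lower:
  "(((**) (vector [vector [1, 0], vector [t, 1]] :: int^2^2)) ^^ n) (mat 1)
     = vector [vector [1, 0], vector [int n * t, 1]]"
  by (induction n; rule matrix_2_eqI)
     (simp_all add: matrix_matrix_mult_def sum_2 mat_def algebra_simps)

lemma mat_zpow_L: "mat_zpow L_mat k = vector [vector [1, k], vector [0, 1]]"
  unfolding mat_zpow_def L_mat_inv unfolding L_mat_def funpow_upper by auto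

lemma mat_zpow_R: "mat_zpow R_mat k = vector [vector [1, 0], vector [k, 1]]"
  unfolding mat_zpow_def R_mat_inv unfolding R_mat_def funpow_lower by auto

end

theory Submission
  imports Defs
begin

text \<open>On the root \<open>w = (- b + \<surd>D) / 2a\<close> the algorithm performs the continued fraction expansion:
  a step with \<open>M_L\<close> replaces \<open>w\<close> by its fractional part, a step with \<open>M_R\<close> does so with \<open>1/w\<close>.
  After the first step \<open>w\<close> is positive, and \<open>ac\<close> decreases until the conjugate root is negative;
  from the next step on all forms are simply reduced, of which there are finitely many for a given
  discriminant. For equivalent forms it suffices to consider \<open>q\<close> and its images under powers of
  \<open>L\<close> and \<open>R\<close>. The former have the same orbit after one step of the algorithm, and the latter have the
  same orbit after one step if the algorithm starts with \<open>M_R\<close> instead. So it remains to see that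
  the two ways of starting lead to the same cycle, which follows from the relation between the
  continued fractions of \<open>f\<close> and \<open>-f\<close>.\<close>

section \<open>Eventually periodic sequences\<close>

lemma periodic_from_mult:
  assumes "periodic_from s N p" "n \<ge> N"
  shows "s (n + k * p) = s n"
proof (induction k)
  case (Suc k)
  have "s (n + k * p + p) = s (n + k * p)"
    using assms unfolding periodic_from_def by (meson trans_le_add1)
  then show ?case
    using Suc by (simp add: algebra_simps)
qed simp

lemma periodic_from_preperiod:
  assumes "becomes_periodic s"
  shows "periodic_from s (preperiod s) (period s)"
proof -
  obtain p where "periodic_from s (preperiod s) p"
    using LeastI_ex[of "\<lambda>N. \<exists>p. periodic_from s N p"] assms
    unfolding becomes_periodic_def preperiod_def by blast
  then show ?thesis
    unfolding period_def by (rule LeastI)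
qed

text \<open>An index can be moved past \<open>M\<close> by a multiple of \<open>period s\<close>
  without changing the value, so \<open>p\<close> is a period already from the preperiod on.\<close>

lemma period_le:
  assumes "periodic_from s M p"
  shows "period s \<le> p"
proof -
  have "becomes_periodic s"
    using assms unfolding becomes_periodic_def by blast
  note per = periodic_from_preperiod[OF this]
  have "s (n + p) = s n" if "n \<ge> preperiod s" for n
  proof -
    have "period s \<ge> 1"
      using per unfolding periodic_from_def by linarith
    then have "n + M * period s \<ge> M"
      by (metis le_add2 mult.right_neutral mult_le_mono2 order_trans)
    then have "s (n + M * period s + p) = s (n + M * period s)"
      using assms unfolding periodic_from_def by blast
    moreover have "s (n + p + M * period s) = s (n + p)" "s (n + M * period s) = s n"
      using that by (auto intro: periodic_from_mult[OF per])
    ultimately show ?thesis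
      by (simp add: algebra_simps)
  qed
  then have "periodic_from s (preperiod s) p"
    using assms unfolding periodic_from_def by blast
  then show ?thesis
    unfolding period_def by (rule Least_le)
qed

text \<open>Far out, \<open>s\<close> and \<open>t\<close> run through the same values, so a period
  of \<open>t\<close> is one of \<open>s\<close>. Used in both directions, this equates the
  periods.\<close>

lemma period_tail_le:
  assumes "becomes_periodic t" and tail: "\<And>i. s (m + i) = t (n + i)"
  shows "period s \<le> period t"
proof -
  note per = periodic_from_preperiod[OF assms(1)]
  have "s (i + period t) = s i" if i: "i \<ge> m + preperiod t" for i
  proof -
    obtain j where j: "i = m + j" "j \<ge> preperiod t"
      by (rule that[of "i - m"]) (use i in auto)
    have "t (n + j + period t) = t (n + j)"
      using per j unfolding periodic_from_def by simp
    then show ?thesis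
      using tail[of j] tail[of "j + period t"] j by (simp add: algebra_simps)
  qed
  then have "periodic_from s (m + preperiod t) (period t)"
    using per unfolding periodic_from_def by blast
  then show ?thesis
    by (rule period_le)
qed

lemma cycles_agree_if_tails_agree:
  assumes s: "becomes_periodic s" and t: "becomes_periodic t"
    and tail: "\<And>i. s (m + i) = t (n + i)"
  shows "cycles_agree (periodic_part s) (periodic_part t)"
proof -
  have same: "period t = period s"
    using period_tail_le[OF t tail] period_tail_le[OF s tail[symmetric]] by (rule antisym[rotated])
  define P where "P = period s"
  define A where "A = n + preperiod s"
  \<comment> \<open>The offset between the starts of the two windows, matched through the common
    tail; the multiple \<open>A * P\<close> of the period keeps the subtraction from
    truncating.\<close>
  define K where "K = m + preperiod t + A * P - n - preperiod s"
  note pers = periodic_from_preperiod[OF s, folded P_def]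
  note pert = periodic_from_preperiod[OF t, unfolded same, folded P_def]
  have P: "P > 0"
    using pers unfolding periodic_from_def by blast
  then have AP: "n + preperiod s \<le> A * P"
    by (simp add: A_def)
  have "t (preperiod t + i) = s (preperiod s + (K + i) mod P)" for i
  proof -
    have "t (preperiod t + i) = t (preperiod t + i + A * P)"
      using periodic_from_mult[OF pert] by simp
    also have "\<dots> = t (n + (preperiod t + i + A * P - n))"
      using AP by simp
    also have "\<dots> = s (m + (preperiod t + i + A * P - n))"
      by (rule tail[symmetric])
    also have "\<dots> = s (preperiod s + (K + i))"
      using AP by (intro arg_cong[where f = s]) (simp add: K_def)
    also have "\<dots> = s (preperiod s + (K + i) mod P + (K + i) div P * P)"
      using mod_div_mult_eq[of "K + i" P] by (intro arg_cong[where f = s]) linarith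
    also have "\<dots> = s (preperiod s + (K + i) mod P)"
      by (rule periodic_from_mult[OF pers]) simp
    finally show ?thesis .
  qed
  then have "periodic_part t = rotate K (periodic_part s)"
    using P by (intro nth_equalityI) (simp_all add: periodic_part_def same nth_rotate flip: P_def)
  then show ?thesis
    unfolding cycles_agree_def by blast
qed

lemma orbit_revisits_if_finite:
  assumes "finite X" "\<And>n. n \<ge> N \<Longrightarrow> (f ^^ n) x \<in> X"
  shows "\<exists>i p. p > 0 \<and> (f ^^ (i + p)) x = (f ^^ i) x"
proof -
  have "\<not> inj_on (\<lambda>n. (f ^^ n) x) {N..}"
    using assms by (metis (no_types, lifting) atLeast_iff finite_imageD image_subsetI
        infinite_Ici rev_finite_subset)
  then obtain i j where "(f ^^ i) x = (f ^^ j) x" "i \<noteq> j"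
    unfolding inj_on_def by blast
  then obtain i j where "(f ^^ i) x = (f ^^ j) x" "i < j"
    by (metis linorder_neqE_nat)
  then show ?thesis
    by (intro exI[of _ i] exI[of _ "j - i"]) simp
qed

section \<open>Equivalence of forms\<close>

lemma act_mult: "act q (A ** B) = act (act q A) B"
  by (rule bqf_eqI) (simp add: bqf_eval_act matrix_matrix_mult_def sum_2 algebra_simps)

lemma act_one [simp]: "act q (mat 1) = q"
  by (rule bqf_eqI) (simp add: bqf_eval_act mat_def)

lemma act_uminus: "act q (- A) = act q A"
  by (cases q) simp

lemma bqf_equiv_act: "det M = 1 \<Longrightarrow> bqf_equiv (act q M) q"
  unfolding bqf_equiv_def by blast

lemma bqf_equiv_trans: "bqf_equiv q1 q2 \<Longrightarrow> bqf_equiv q2 q3 \<Longrightarrow> bqf_equiv q1 q3"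
  unfolding bqf_equiv_def by (metis act_mult det_mul mult_1)

lemma bqf_equiv_sym:
  assumes "bqf_equiv q1 q2"
  shows "bqf_equiv q2 q1"
proof -
  obtain M where M: "det M = 1" "q1 = act q2 M"
    using assms unfolding bqf_equiv_def by blast
  \<comment> \<open>The adjugate, inverse to \<open>M\<close> as the determinant is 1.\<close>
  define N :: "int^2^2" where "N = vector [vector [M$2$2, - M$1$2], vector [- M$2$1, M$1$1]]"
  have "M ** N = mat 1"
    using M(1) by (intro matrix_2_eqI)
      (simp_all add: N_def matrix_matrix_mult_def sum_2 mat_def det_2 algebra_simps)
  moreover have "det N = 1"
    using M(1) by (simp add: N_def det_2 algebra_simps)
  ultimately show ?thesis
    unfolding bqf_equiv_def using M(2) by (metis act_mult act_one)
qed

abbreviation mat22 :: "int \<Rightarrow> int \<Rightarrow> int \<Rightarrow> int \<Rightarrow> int^2^2" where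
  "mat22 \<alpha> \<beta> \<gamma> \<delta> \<equiv> vector [vector [\<alpha>, \<beta>], vector [\<gamma>, \<delta>]]"

lemma mat22_mult:
  "mat22 \<alpha> \<beta> \<gamma> \<delta> ** mat22 \<alpha>' \<beta>' \<gamma>' \<delta>' =
     mat22 (\<alpha> * \<alpha>' + \<beta> * \<gamma>') (\<alpha> * \<beta>' + \<beta> * \<delta>') (\<gamma> * \<alpha>' + \<delta> * \<gamma>') (\<gamma> * \<beta>' + \<delta> * \<delta>')"
  by (rule matrix_2_eqI) (simp_all add: matrix_matrix_mult_def sum_2)

lemma uminus_mat22: "- mat22 \<alpha> \<beta> \<gamma> \<delta> = mat22 (- \<alpha>) (- \<beta>) (- \<gamma>) (- \<delta>)"
  by (rule matrix_2_eqI) simp_all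

text \<open>The Euclidean algorithm on the first column.\<close>

lemma SL2_induct [consumes 1, case_names upper lower mult uminus]:
  fixes M :: "int^2^2"
  assumes "det M = 1"
    and upper: "\<And>k. P (mat22 1 k 0 1)" and lower: "\<And>k. P (mat22 1 0 k 1)"
    and mult: "\<And>A B. P A \<Longrightarrow> P B \<Longrightarrow> P (A ** B)" and uminus: "\<And>A. P A \<Longrightarrow> P (- A)"
  shows "P M"
proof -
  have triangular: "P (mat22 \<alpha> \<beta> 0 \<delta>)" if "\<alpha> * \<delta> = 1" for \<alpha> \<beta> \<delta>
  proof -
    have "\<alpha> = 1 \<and> \<delta> = 1 \<or> \<alpha> = -1 \<and> \<delta> = -1"
      using that zmult_eq_1_iff by blast
    then show ?thesis
      using upper[of \<beta>] uminus[OF upper[of "- \<beta>"]] by (auto simp: uminus_mat22)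
  qed
  have "P (mat22 \<alpha> \<beta> \<gamma> \<delta>)" if "\<alpha> * \<delta> - \<beta> * \<gamma> = 1" for \<alpha> \<beta> \<gamma> \<delta>
    using that
  proof (induction "nat (\<bar>\<alpha>\<bar> + \<bar>\<gamma>\<bar>)" arbitrary: \<alpha> \<beta> \<gamma> \<delta> rule: less_induct)
    case less
    have L: "P (mat22 \<alpha> \<beta> \<gamma> \<delta>)" if "P (mat22 (\<alpha> - k * \<gamma>) (\<beta> - k * \<delta>) \<gamma> \<delta>)" for k
      using mult[OF upper[of k] that] by (simp add: mat22_mult)
    have R: "P (mat22 \<alpha> \<beta> \<gamma> \<delta>)" if "P (mat22 \<alpha> \<beta> (\<gamma> - k * \<alpha>) (\<delta> - k * \<beta>))" for k
      using mult[OF lower[of k] that] by (simp add: mat22_mult)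
    \<comment> \<open>The sign that makes the two entries of the column cancel rather than add
      up.\<close>
    define k where "k = sgn \<alpha> * sgn \<gamma>"
    consider "\<gamma> = 0" | "\<alpha> = 0" | "\<alpha> \<noteq> 0" "\<gamma> \<noteq> 0" "\<bar>\<gamma>\<bar> \<le> \<bar>\<alpha>\<bar>" | "\<alpha> \<noteq> 0" "\<gamma> \<noteq> 0" "\<bar>\<alpha>\<bar> < \<bar>\<gamma>\<bar>"
      by linarith
    then show ?case
    proof cases
      case 1
      then show ?thesis
        using triangular less.prems by simp
    next
      case 2
      \<comment> \<open>The column is already as short as possible; adding the second row to the
        first makes it possible to clear \<open>\<gamma>\<close>.\<close>
      have "P (mat22 \<gamma> (\<beta> + \<delta>) 0 (- \<beta>))"
        using triangular[of \<gamma> "- \<beta>"] less.prems 2 by (simp add: mult.commute)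
      from mult[OF lower[of 1] this] have "P (mat22 (\<alpha> + \<gamma>) (\<beta> + \<delta>) \<gamma> \<delta>)"
        using 2 by (simp add: mat22_mult)
      then show ?thesis
        using L[of "- 1"] by simp
    next
      case 3
      have "\<bar>\<alpha> - k * \<gamma>\<bar> < \<bar>\<alpha>\<bar>"
        using 3 by (auto simp: k_def sgn_if)
      then show ?thesis
        using 3 less.prems by (intro L[of k] less.hyps) (auto simp: algebra_simps)
    next
      case 4
      have "\<bar>\<gamma> - k * \<alpha>\<bar> < \<bar>\<gamma>\<bar>"
        using 4 by (auto simp: k_def sgn_if)
      then show ?thesis
        using 4 less.prems by (intro R[of k] less.hyps) (auto simp: algebra_simps)
    qed
  qed
  moreover have "M = mat22 (M$1$1) (M$1$2) (M$2$1) (M$2$2)"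
    by (rule matrix_2_eqI) simp_all
  ultimately show ?thesis
    using assms(1) by (metis det_2)
qed

section \<open>The Gauss map on forms\<close>

fun translate :: "int \<Rightarrow> bqf \<Rightarrow> bqf" where
  "translate k (Form a b c) = Form a (b + 2 * a * k) (a * k\<^sup>2 + b * k + c)"

text \<open>Besides exchanging the variables, \<open>flip\<close> changes the sign, so that \<open>first_root\<close> below
  is mapped to its own inverse and not to that of the other root.\<close>

fun flip :: "bqf \<Rightarrow> bqf" where
  "flip (Form a b c) = Form (- c) (- b) (- a)"

text \<open>The sign of the square root, not the size, singles out this root: for
  \<open>a < 0\<close> it is the smaller one.\<close>

fun first_root :: "bqf \<Rightarrow> real" where
  "first_root (Form a b c) = (- real_of_int b + sqrt (disc (Form a b c))) / (2 * real_of_int a)"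

fun second_root :: "bqf \<Rightarrow> real" where
  "second_root (Form a b c) = (- real_of_int b - sqrt (disc (Form a b c))) / (2 * real_of_int a)"

definition gauss :: "bqf \<Rightarrow> bqf" where
  "gauss q = flip (translate \<lfloor>first_root q\<rfloor> q)"

definition irrational_form :: "bqf \<Rightarrow> bool" where
  "irrational_form q \<longleftrightarrow> disc q > 0 \<and> \<not> (\<exists>n. disc q = n\<^sup>2)"

lemma act_upper: "act q (mat22 1 k 0 1) = translate k q"
  by (cases q) (simp add: algebra_simps power2_eq_square)

lemma act_lower: "act q (mat22 1 0 k 1) = flip (translate k (flip q))"
  by (cases q) (simp add: algebra_simps power2_eq_square)

lemma flip_flip [simp]: "flip (flip q) = q"
  by (cases q) simp

lemma translate_0 [simp]: "translate 0 q = q"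
  by (cases q) simp

lemma translate_translate: "translate k (translate l q) = translate (k + l) q"
  by (cases q) (simp add: algebra_simps power2_eq_square)

lemma disc_flip [simp]: "disc (flip q) = disc q"
  by (cases q) simp

lemma disc_translate [simp]: "disc (translate k q) = disc q"
  by (cases q) (simp add: algebra_simps power2_eq_square)

lemma disc_gauss_funpow [simp]: "disc ((gauss ^^ n) q) = disc q"
  by (induction n) (simp_all add: gauss_def)

lemma irrational_form_simps [simp]:
  "irrational_form (flip q) \<longleftrightarrow> irrational_form q"
  "irrational_form (translate k q) \<longleftrightarrow> irrational_form q"
  "irrational_form ((gauss ^^ n) q) \<longleftrightarrow> irrational_form q"
  by (simp_all add: irrational_form_def)

lemma irrational_form_gauss [simp]: "irrational_form (gauss q) \<longleftrightarrow> irrational_form q"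
  by (simp add: gauss_def)

lemma irrational_form_coeffs:
  assumes "irrational_form (Form a b c)"
  shows "a \<noteq> 0" "c \<noteq> 0"
  using assms unfolding irrational_form_def by auto

lemma irrational_form_nonzero:
  assumes "irrational_form (Form a b c)"
  shows "a * k\<^sup>2 + b * k + c \<noteq> 0"
proof
  assume "a * k\<^sup>2 + b * k + c = 0"
  then have "b\<^sup>2 - 4 * a * c = (2 * a * k + b)\<^sup>2" by algebra
  then show False
    using assms unfolding irrational_form_def by auto
qed

section \<open>Behaviour of the two roots\<close>

lemma roots_translate:
  assumes "irrational_form q"
  shows "first_root (translate k q) = first_root q - k"
    and "second_root (translate k q) = second_root q - k"
proof -
  obtain a b c where q: "q = Form a b c" by (cases q)
  have "a \<noteq> 0" using assms irrational_form_coeffs q by blast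
  moreover have "disc (Form a (b + 2 * a * k) (a * k\<^sup>2 + b * k + c)) = disc (Form a b c)"
    using disc_translate[of k "Form a b c"] by simp
  ultimately show "first_root (translate k q) = first_root q - k"
    and "second_root (translate k q) = second_root q - k"
    unfolding q by (simp_all del: disc.simps add: field_simps)
qed

text \<open>With \<open>r\<close> the square root of the discriminant,
  \<open>(- b + r) * (b + r) = - 4 * a * c\<close>; the change of sign in \<open>flip\<close> keeps
  the sign of \<open>r\<close>.\<close>

lemma roots_flip:
  assumes "irrational_form q"
  shows "first_root (flip q) = 1 / first_root q"
    and "second_root (flip q) = 1 / second_root q"
proof -
  obtain a b c where q: "q = Form a b c" by (cases q)
  define r where "r = sqrt (disc (Form a b c))"
  have ac: "a \<noteq> 0" "c \<noteq> 0" using assms irrational_form_coeffs q by auto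
  have d: "disc (Form (- c) (- b) (- a)) = disc (Form a b c)"
    using disc_flip[of "Form a b c"] by simp
  have "r\<^sup>2 = real_of_int (disc (Form a b c))"
    using assms unfolding irrational_form_def q r_def by (simp del: disc.simps)
  then have r: "r * r = real_of_int b * b - 4 * a * c"
    by (simp add: power2_eq_square)
  have "(- b + r) * (b + r) = 4 * a * - c" "(- b - r) * (b - r) = 4 * a * - c"
    using r by (simp_all add: algebra_simps)
  moreover from this have "- b + r \<noteq> 0" "- b - r \<noteq> 0"
    using ac by auto
  ultimately show "first_root (flip q) = 1 / first_root q"
    and "second_root (flip q) = 1 / second_root q"
    unfolding q using ac by (simp_all del: disc.simps add: d field_simps flip: r_def)
qed

text \<open>This factorization turns the position of the roots into signs of values of the
  form.\<close>

lemma bqf_eval_roots: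
  assumes "irrational_form (Form a b c)"
  shows "a * (k - first_root (Form a b c)) * (k - second_root (Form a b c)) = a * k\<^sup>2 + b * k + c"
proof -
  define r where "r = sqrt (disc (Form a b c))"
  have a: "a \<noteq> 0" using assms irrational_form_coeffs by blast
  have "r\<^sup>2 = real_of_int (disc (Form a b c))"
    using assms unfolding irrational_form_def r_def by (simp del: disc.simps)
  then have r: "r * r = real_of_int b * b - 4 * a * c"
    by (simp add: power2_eq_square)
  have "4 * a * (a * k\<^sup>2 + b * k + c) = (2 * a * k + b - r) * (2 * a * k + b + r)"
    using r by (simp add: algebra_simps power2_eq_square)
  moreover have "k - first_root (Form a b c) = (2 * a * k + b - r) / (2 * a)"
    "k - second_root (Form a b c) = (2 * a * k + b + r) / (2 * a)"
    using a by (simp_all del: disc.simps add: field_simps flip: r_def)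
  ultimately have "a * (k - first_root (Form a b c)) * (k - second_root (Form a b c))
      = a * (4 * a * (a * k\<^sup>2 + b * k + c)) / (4 * a * a)"
    by (simp only:) simp
  then show ?thesis
    using a by simp
qed

lemma roots_not_int:
  assumes "irrational_form q"
  shows "first_root q \<noteq> of_int k" "second_root q \<noteq> of_int k"
proof -
  obtain a b c where q: "q = Form a b c" by (cases q)
  have "of_int (a * k\<^sup>2 + b * k + c) \<noteq> (0::real)"
    using irrational_form_nonzero assms q by (metis of_int_eq_0_iff)
  then show "first_root q \<noteq> of_int k" "second_root q \<noteq> of_int k"
    using bqf_eval_roots[of a b c k] assms q by auto
qed

lemma first_root_gauss:
  assumes "irrational_form q"
  shows "first_root (gauss q) > 1"
proof -
  have "0 < first_root q - \<lfloor>first_root q\<rfloor>" "first_root q - \<lfloor>first_root q\<rfloor> < 1"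
    using roots_not_int(1)[OF assms, of "\<lfloor>first_root q\<rfloor>"] by linarith+
  then show ?thesis
    using assms by (simp add: gauss_def roots_flip roots_translate)
qed

lemma roots_difference:
  assumes "irrational_form (Form a b c)"
  shows "first_root (Form a b c) - second_root (Form a b c) = sqrt (disc (Form a b c)) / a"
  using irrational_form_coeffs[OF assms] by (simp del: disc.simps add: field_simps)

text \<open>An \<open>M_R\<close> step is an \<open>M_L\<close> step conjugated by
  \<open>flip\<close>, so alternating the two amounts to iterating \<open>gauss\<close>, up to a
  \<open>flip\<close> at odd indices.\<close>

lemma reduction_seq_eq:
  "reduction_seq q n = (flip ^^ n) ((gauss ^^ n) q)"
proof (induction n)
  case (Suc n)
  have flip_even: "(flip ^^ m) p = (if even m then p else flip p)" for m p
    by (induction m) auto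
  have M_L: "act p (M_L p) = translate \<lfloor>first_root p\<rfloor> p" for p
    by (cases p) (simp only: M_L.simps mat_zpow_L act_upper first_root.simps)
  have root: "first_root (flip (Form a b c)) = - ((b + sqrt (disc (Form a b c))) / (2 * c))" for a b c
    using disc_flip[of "Form a b c"] by (simp del: disc.simps add: field_simps)
  have M_R: "act p (M_R p) = flip (translate \<lfloor>first_root (flip p)\<rfloor> (flip p))" for p
    by (cases p) (simp only: M_R.simps mat_zpow_R act_lower root)
  show ?case
    unfolding reduction_seq.simps Suc.IH step_mat_def
    by (cases "even n") (simp_all add: flip_even M_L M_R gauss_def[of "(gauss ^^ n) q"])
qed simp

section \<open>Periodicity\<close>

lemma simply_reduced_flip [simp]: "simply_reduced (flip q) \<longleftrightarrow> simply_reduced q"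
  by (cases q) (auto simp: algebra_simps)

text \<open>The first root exceeds the second, so \<open>a > 0\<close>. The condition on
  \<open>b\<close> says that \<open>a + b + c\<close> and \<open>a - b + c\<close> have opposite
  signs; these are the values at 1 and -1, and \<open>c\<close> is the value at 0.\<close>

lemma simply_reducedI:
  assumes "irrational_form q" "0 < first_root q" "first_root q < 1" "second_root q < -1"
  shows "simply_reduced q"
proof -
  obtain a b c where q: "q = Form a b c" by (cases q)
  note roots = bqf_eval_roots[OF assms(1)[unfolded q], folded q]
  have "sqrt (disc q) / a > 0"
    using roots_difference[OF assms(1)[unfolded q]] assms unfolding q by linarith
  then have a: "real_of_int a > 0"
    using assms(1) unfolding irrational_form_def by (simp add: zero_less_divide_iff)
  have "a * (0 - first_root q) * (0 - second_root q) < 0"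
    using a assms by (intro mult_neg_pos mult_pos_neg) auto
  then have "real_of_int c < 0"
    using roots[of 0] by simp
  moreover have "a * (1 - first_root q) * (1 - second_root q) > 0"
    using a assms by (intro mult_pos_pos) auto
  then have "real_of_int (a + b + c) > 0"
    using roots[of 1] by simp
  moreover have "a * (- 1 - first_root q) * (- 1 - second_root q) < 0"
    using a assms by (intro mult_neg_pos mult_pos_neg) auto
  then have "real_of_int (a - b + c) < 0"
    using roots[of "- 1"] by simp
  ultimately show ?thesis
    using a unfolding q by simp
qed

text \<open>Subtracting the floor, which is at least 1, brings the first root into (0, 1) and the
  second below -1; the \<open>flip\<close> that follows preserves simple reducedness.\<close>

lemma gauss_reduced:
  assumes "irrational_form q" "first_root q > 1" "second_root q < 0"
  shows "simply_reduced (gauss q)" "second_root (gauss q) < 0"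
proof -
  define k where "k = \<lfloor>first_root q\<rfloor>"
  have "k \<ge> 1"
    using assms(2) unfolding k_def by linarith
  then have second: "second_root q - k < - 1"
    using assms(3) by linarith
  then show "second_root (gauss q) < 0"
    using assms(1) by (simp add: gauss_def roots_flip roots_translate flip: k_def)
  have "0 < first_root q - k" "first_root q - k < 1"
    using roots_not_int(1)[OF assms(1), of k] unfolding k_def by linarith+
  then show "simply_reduced (gauss q)"
    using second assms(1) unfolding gauss_def k_def[symmetric]
    by (simp add: simply_reducedI roots_translate)
qed

text \<open>As long as both roots stay positive, the product of the outer coefficients decreases.\<close>

lemma gauss_second_root_neg:
  assumes "irrational_form q" "first_root q > 1"
  shows "\<exists>n. second_root ((gauss ^^ n) q) < 0"
  using assms
proof (induction "nat (coeff_a q * coeff_c q)" arbitrary: q rule: less_induct)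
  case less
  show ?case
  proof (cases "second_root q < 0 \<or> second_root (gauss q) < 0")
    case True
    then show ?thesis
      by (metis funpow_0 funpow.simps(2) comp_apply)
  next
    case False
    obtain a b c where q: "q = Form a b c" by (cases q)
    define w where "w = first_root q"
    define v where "v = second_root q"
    define k where "k = \<lfloor>first_root q\<rfloor>"
    have irr: "irrational_form (Form a b c)"
      using less.prems q by simp
    have k: "k \<ge> 1" "k < w"
      using less.prems roots_not_int(1)[of q k] unfolding k_def w_def by linarith+
    have "second_root (gauss q) = 1 / (v - k)"
      using less.prems by (simp add: gauss_def roots_flip roots_translate v_def flip: k_def)
    moreover have "1 / (v - k) \<noteq> 0"
      using roots_not_int(2)[of q k] less.prems unfolding v_def by simp
    ultimately have v: "k < v"
      using False zero_less_divide_1_iff[of "v - k"] by linarith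
    \<comment> \<open>The outer coefficients of \<open>gauss q\<close> are minus the value of the
      form at \<open>k\<close> and \<open>- a\<close>.\<close>
    have prod: "real_of_int (coeff_a (gauss q) * coeff_c (gauss q)) = a\<^sup>2 * ((w - k) * (v - k))"
      using bqf_eval_roots[OF irr, of k] unfolding gauss_def k_def[symmetric]
      by (simp del: first_root.simps second_root.simps
          add: q w_def v_def power2_eq_square algebra_simps)
    also have "\<dots> < a\<^sup>2 * (w * v)"
      using irrational_form_coeffs[OF irr] k v
      by (intro mult_strict_left_mono mult_strict_mono) auto
    also have "\<dots> = real_of_int (coeff_a q * coeff_c q)"
      using bqf_eval_roots[OF irr, of 0]
      by (simp del: first_root.simps second_root.simps
          add: q w_def v_def power2_eq_square algebra_simps)
    finally have "coeff_a (gauss q) * coeff_c (gauss q) < coeff_a q * coeff_c q"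
      by (simp only: of_int_less_iff)
    \<comment> \<open>Nonnegativity makes the decrease carry over to the \<open>nat\<close>
      measure.\<close>
    moreover have "real_of_int (coeff_a (gauss q) * coeff_c (gauss q)) \<ge> 0"
      unfolding prod using k v by simp
    then have "coeff_a (gauss q) * coeff_c (gauss q) \<ge> 0"
      by (simp only: of_int_0_le_iff)
    ultimately obtain n where "second_root ((gauss ^^ n) (gauss q)) < 0"
      using less.hyps[of "gauss q"] less.prems first_root_gauss[of q] by auto
    then have "second_root ((gauss ^^ Suc n) q) < 0"
      by (simp only: funpow_Suc_right o_apply)
    then show ?thesis
      by blast
  qed
qed

lemma gauss_funpow_simply_reduced:
  assumes "irrational_form q"
  shows "\<exists>N. \<forall>n\<ge>N. simply_reduced ((gauss ^^ n) q)"
proof -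
  obtain m where "second_root ((gauss ^^ m) (gauss q)) < 0"
    using gauss_second_root_neg[of "gauss q"] first_root_gauss[OF assms] assms by auto
  then have m: "second_root ((gauss ^^ Suc m) q) < 0"
    by (simp only: funpow_Suc_right o_apply)
  have first: "first_root ((gauss ^^ Suc n) q) > 1" for n
    using first_root_gauss[of "(gauss ^^ n) q"] assms by simp
  have "second_root ((gauss ^^ Suc (m + i)) q) < 0" for i
  proof (induction i)
    case (Suc i)
    then show ?case
      using gauss_reduced(2)[of "(gauss ^^ Suc (m + i)) q"] first[of "m + i"] assms by simp
  qed (use m in simp)
  then have "simply_reduced ((gauss ^^ Suc (Suc (m + i))) q)" for i
    using gauss_reduced(1)[of "(gauss ^^ Suc (m + i)) q"] first[of "m + i"] assms by simp
  then have "simply_reduced ((gauss ^^ n) q)" if "n \<ge> Suc (Suc m)" for n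
    using that by (metis add_Suc le_Suc_ex)
  then show ?thesis
    by blast
qed

text \<open>As \<open>a\<close> and \<open>c\<close> have opposite signs, \<open>D\<close> is a sum
  of nonnegative terms that bounds all coefficients.\<close>

lemma finite_simply_reduced: "finite {q. simply_reduced q \<and> disc q = D}"
proof (rule finite_subset)
  show "{q. simply_reduced q \<and> disc q = D}
          \<subseteq> (\<lambda>(a, b, c). Form a b c) ` ({- D..D} \<times> {- D..D} \<times> {- D..D})"
  proof
    fix q assume q: "q \<in> {q. simply_reduced q \<and> disc q = D}"
    obtain a b c where abc: "q = Form a b c" by (cases q)
    have ac: "a > 0" "c < 0" and D: "D = b\<^sup>2 + 4 * (a * - c)"
      using q abc by auto
    have "a \<le> a * - c" "- c \<le> a * - c"
      using ac mult_left_mono[of 1 "- c" a] mult_right_mono[of 1 a "- c"] by auto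
    moreover have "\<bar>b\<bar> \<le> b\<^sup>2"
      using self_le_power[of "\<bar>b\<bar>" 2] by (cases "b = 0") auto
    ultimately have "a \<le> D" "- c \<le> D" "\<bar>b\<bar> \<le> D"
      using D ac zero_le_power2[of b] by linarith+
    then show "q \<in> (\<lambda>(a, b, c). Form a b c) ` ({- D..D} \<times> {- D..D} \<times> {- D..D})"
      using abc ac by (intro image_eqI[of _ _ "(a, b, c)"]) auto
  qed
qed simp

lemma reduction_seq_becomes_periodic:
  assumes "irrational_form q"
  shows "becomes_periodic (reduction_seq q)"
proof -
  obtain N where "\<And>n. n \<ge> N \<Longrightarrow> simply_reduced ((gauss ^^ n) q)"
    using gauss_funpow_simply_reduced[OF assms] by blast
  then have "(gauss ^^ n) q \<in> {r. simply_reduced r \<and> disc r = disc q}" if "n \<ge> N" for n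
    using that by simp
  from orbit_revisits_if_finite[OF finite_simply_reduced this]
  obtain i p where p: "p > 0" "(gauss ^^ (i + p)) q = (gauss ^^ i) q"
    by blast
  have *: "(gauss ^^ (n + p)) q = (gauss ^^ n) q" if "n \<ge> i" for n
  proof -
    have "(gauss ^^ (n - i + (i + p))) q = (gauss ^^ (n - i + i)) q"
      by (simp only: funpow_add[of "n - i"] o_apply p(2))
    then show ?thesis
      using that by simp
  qed
  \<comment> \<open>An odd \<open>p\<close> would exchange the two kinds of step; doubling it makes
    the number of flips even.\<close>
  have **: "(flip ^^ (n + 2 * p)) r = (flip ^^ n) r" for n r
  proof -
    have "(flip ^^ (2 * p)) r = r"
      by (induction p) auto
    then show ?thesis
      by (simp add: funpow_add)
  qed
  have "reduction_seq q (n + 2 * p) = reduction_seq q n" if "n \<ge> i" for n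
    using *[of n] *[of "n + p"] that **[of n] by (simp add: reduction_seq_eq mult_2 add.assoc)
  then have "periodic_from (reduction_seq q) i (2 * p)"
    using p(1) unfolding periodic_from_def by simp
  then show ?thesis
    unfolding becomes_periodic_def by blast
qed

text \<open>Every member of the cycle recurs arbitrarily late, where all iterates are simply
  reduced.\<close>

lemma simple_cycle_simply_reduced:
  assumes "irrational_form q" "f \<in> set (simple_cycle q)"
  shows "simply_reduced f"
proof -
  obtain N where N: "\<And>n. n \<ge> N \<Longrightarrow> simply_reduced ((gauss ^^ n) q)"
    using gauss_funpow_simply_reduced[OF assms(1)] by blast
  have reduced: "simply_reduced (reduction_seq q n)" if "n \<ge> N" for n
  proof -
    have "simply_reduced ((flip ^^ n) r) \<longleftrightarrow> simply_reduced r" for r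
      by (induction n) auto
    then show ?thesis
      using N[OF that] by (simp add: reduction_seq_eq)
  qed
  note per = periodic_from_preperiod[OF reduction_seq_becomes_periodic[OF assms(1)]]
  obtain n where n: "n \<ge> preperiod (reduction_seq q)" "f = reduction_seq q n"
    using assms(2) unfolding simple_cycle_def periodic_part_def by auto
  have "period (reduction_seq q) \<ge> 1"
    using per unfolding periodic_from_def by linarith
  then have "n + N * period (reduction_seq q) \<ge> N"
    by (metis le_add2 mult.right_neutral mult_le_mono2 order_trans)
  from reduced[OF this] show ?thesis
    using periodic_from_mult[OF per n(1)] n(2) by simp
qed

section \<open>Merging orbits\<close>

text \<open>Parity matters because the two kinds of step alternate in \<open>reduction_seq\<close>, whereas
  \<open>gauss\<close> treats them alike by means of \<open>flip\<close>.\<close>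

definition merges :: "bool \<Rightarrow> bqf \<Rightarrow> bqf \<Rightarrow> bool" where
  "merges e q q' \<longleftrightarrow> (\<exists>m n. (even (m + n) \<longleftrightarrow> e) \<and> (gauss ^^ m) q = (gauss ^^ n) q')"

lemma merges_sym: "merges e q q' \<Longrightarrow> merges e q' q"
  unfolding merges_def by (metis add.commute)

lemma merges_trans [trans]:
  assumes "merges e q q'" "merges e' q' q''"
  shows "merges (e = e') q q''"
proof -
  obtain m n where 1: "even (m + n) \<longleftrightarrow> e" "(gauss ^^ m) q = (gauss ^^ n) q'"
    using assms(1) unfolding merges_def by blast
  obtain k l where 2: "even (k + l) \<longleftrightarrow> e'" "(gauss ^^ k) q' = (gauss ^^ l) q''"
    using assms(2) unfolding merges_def by blast
  have "(gauss ^^ (k + m)) q = (gauss ^^ (k + n)) q'"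
    by (simp add: funpow_add 1)
  also have "\<dots> = (gauss ^^ (n + k)) q'"
    by (simp add: add.commute)
  also have "\<dots> = (gauss ^^ (n + l)) q''"
    by (simp add: funpow_add 2)
  finally show ?thesis
    using 1(1) 2(1) unfolding merges_def by (intro exI[of _ "k + m"] exI[of _ "n + l"]) auto
qed

text \<open>The fractional part of the first root ignores integer shifts.\<close>

lemma merges_translate:
  assumes "irrational_form q"
  shows "merges True q (translate k q)"
proof -
  have "gauss (translate k q) = gauss q"
    using assms by (simp add: gauss_def roots_translate translate_translate)
  then show ?thesis
    unfolding merges_def by (intro exI[of _ 1]) simp
qed

text \<open>One of \<open>q\<close> and \<open>flip q\<close> has its first root above 1. The other
  has it in (0, 1), with floor 0, so a single step leads from it to the former.\<close>

lemma merges_flip_pos: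
  assumes "irrational_form q" "first_root q > 0"
  shows "merges False q (flip q)"
proof -
  have *: "merges False (flip r) r" if "irrational_form r" "first_root r > 1" for r
  proof -
    have "\<lfloor>first_root (flip r)\<rfloor> = 0"
      using that by (simp add: roots_flip floor_eq_iff)
    then have "gauss (flip r) = r"
      by (simp add: gauss_def)
    then show ?thesis
      unfolding merges_def by (intro exI[of _ 1] exI[of _ 0]) simp
  qed
  have "first_root q \<noteq> 1"
    using roots_not_int(1)[OF assms(1), of 1] by simp
  then consider "first_root q > 1" | "first_root (flip q) > 1"
    using assms by (auto simp: roots_flip less_divide_eq linorder_neq_iff)
  then show ?thesis
    using *[of q] *[of "flip q"] assms(1) by cases (auto intro: merges_sym)
qed

text \<open>Write \<open>w\<close> for the first root and \<open>f = w + n\<close> with \<open>0 < f < 1\<close>. The forms in the chain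
  have the first roots \<open>1/w\<close>, \<open>1 + 1/w\<close>, \<open>w/(w + 1)\<close>, \<open>-1/(w + 1)\<close>, \<open>-(w + 1)\<close>, \<open>1 - f\<close>,
  \<open>1/(1 - f)\<close>, \<open>f/(1 - f)\<close>, \<open>1/f - 1\<close>, \<open>1/f\<close>, \<open>f\<close> and \<open>w\<close>; those to which \<open>merges_flip_pos\<close> is
  applied are positive. This is the continued fraction of \<open>-f\<close> in terms of that of \<open>f\<close>.\<close>

lemma merges_flip_less:
  assumes irr: "irrational_form q" and w: "first_root q < -1"
  shows "merges False (flip q) q"
proof -
  define n where "n = - \<lfloor>first_root q\<rfloor>"
  define f where "f = first_root q + n"
  have f: "0 < f" "f < 1"
    using roots_not_int(1)[OF irr, of "- n"] unfolding f_def n_def by linarith+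
  define q1 where "q1 = translate (- 1) (flip q)"
  define q2 where "q2 = translate 1 (flip q1)"
  \<comment> \<open>The shift that turns \<open>-(w + 1)\<close> into \<open>1 - f\<close>.\<close>
  define q3 where "q3 = translate (n - 2) (flip q2)"
  define q4 where "q4 = translate 1 (flip q3)"
  define q5 where "q5 = translate (- 1) (flip q4)"
  have irr': "irrational_form q1" "irrational_form q2" "irrational_form q3" "irrational_form q4"
    "irrational_form q5"
    by (simp_all add: q1_def q2_def q3_def q4_def q5_def irr)
  have "first_root q1 = 1 / first_root q + 1"
    by (simp add: q1_def roots_translate roots_flip irr)
  also have "\<dots> = (first_root q + 1) / first_root q"
    using w by (simp add: field_simps)
  finally have w1: "first_root q1 = (first_root q + 1) / first_root q" .
  have w2: "first_root q2 = - 1 / (first_root q + 1)"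
    using w by (simp add: q2_def roots_translate roots_flip irr' w1 field_simps)
  have w3: "first_root q3 = 1 - f"
    using w by (simp add: q3_def roots_translate roots_flip irr' w2 f_def)
  have w4: "first_root q4 = f / (1 - f)"
    using f by (simp add: q4_def roots_translate roots_flip irr' w3 field_simps)
  have w5: "first_root q5 = 1 / f"
    using f by (simp add: q5_def roots_translate roots_flip irr' w4 field_simps)
  have pos: "first_root q1 > 0" "first_root q2 > 0" "first_root q3 > 0" "first_root q4 > 0"
    "first_root q5 > 0"
    using w f unfolding w1 w2 w3 w4 w5 by (auto intro: divide_neg_neg)
  have step: "merges False r (translate k (flip r))" if "irrational_form r" "first_root r > 0" for r k
    using merges_trans[OF merges_flip_pos[OF that] merges_translate, of k] that by simp
  \<comment> \<open>The chain closes up on the forms themselves, not merely on their first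
    roots.\<close>
  have q: "translate n (flip q5) = q"
    unfolding q1_def q2_def q3_def q4_def q5_def
    by (cases q) (simp add: algebra_simps power2_eq_square)
  \<comment> \<open>Each of the five links after this one contains one \<open>flip\<close>; their
    odd number yields \<open>False\<close>.\<close>
  have "merges True (flip q) q1"
    unfolding q1_def by (rule merges_translate) (simp add: irr)
  also have "merges False q1 q2"
    unfolding q2_def by (rule step) (use irr' pos in auto)
  also have "merges False q2 q3"
    unfolding q3_def by (rule step) (use irr' pos in auto)
  also have "merges False q3 q4"
    unfolding q4_def by (rule step) (use irr' pos in auto)
  also have "merges False q4 q5"
    unfolding q5_def by (rule step) (use irr' pos in auto)
  also have "merges False q5 q"
    using step[of q5 n] irr' pos unfolding q by auto
  finally show ?thesis by simp
qed

text \<open>If the first root lies between -1 and 0, that of \<open>flip q\<close> lies below -1.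
  This compares the two ways of starting the algorithm.\<close>

lemma merges_flip:
  assumes "irrational_form q"
  shows "merges False q (flip q)"
proof -
  have "first_root q \<noteq> -1" "first_root q \<noteq> 0"
    using roots_not_int(1)[OF assms, of "- 1"] roots_not_int(1)[OF assms, of 0] by auto
  then consider "first_root q > 0" | "first_root q < -1" | "first_root (flip q) < -1"
    using assms by (auto simp: roots_flip divide_less_eq) argo
  then show ?thesis
    using merges_flip_pos[OF assms] merges_flip_less[of q] merges_flip_less[of "flip q"] assms
    by cases (auto intro: merges_sym)
qed

text \<open>Checked on generators: a lower triangular matrix acts as a translation between two
  flips, whose parities cancel.\<close>

lemma merges_act:
  assumes "det M = 1"
  shows "irrational_form q \<Longrightarrow> merges True q (act q M)"
proof -
  \<comment> \<open>Irrationality is carried along because the second factor of a product acts on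
    \<open>act q A\<close>.\<close>
  have "\<forall>q. irrational_form q \<longrightarrow> irrational_form (act q M) \<and> merges True q (act q M)"
    using assms
  proof (induction rule: SL2_induct)
    case (upper k)
    then show ?case
      by (simp add: act_upper merges_translate)
  next
    case (lower k)
    have "merges True q (flip (translate k (flip q)))" if "irrational_form q" for q
    proof -
      have "merges False q (flip q)"
        by (rule merges_flip[OF that])
      also have "merges True (flip q) (translate k (flip q))"
        by (rule merges_translate) (simp add: that)
      also have "merges False (translate k (flip q)) (flip (translate k (flip q)))"
        by (rule merges_flip) (simp add: that)
      finally show ?thesis by simp
    qed
    then show ?case
      by (simp add: act_lower)
  next
    case (mult A B)
    then show ?case
      unfolding act_mult by (metis (full_types) merges_trans)
  next
    case (uminus A)
    then show ?case
      by (simp add: act_uminus)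
  qed
  then show "irrational_form q \<Longrightarrow> merges True q (act q M)"
    by blast
qed

text \<open>As \<open>m + n\<close> is even, \<open>m + i\<close> and \<open>n + i\<close> have
  equal parity, so the same flips apply to both orbits.\<close>

lemma cycles_agree_if_merges:
  assumes "irrational_form q" "irrational_form q'" "merges True q q'"
  shows "cycles_agree (simple_cycle q) (simple_cycle q')"
proof -
  obtain m n where mn: "even (m + n)" "(gauss ^^ m) q = (gauss ^^ n) q'"
    using assms(3) unfolding merges_def by blast
  have flip: "(flip ^^ k) r = (if even k then r else flip r)" for k r
    by (induction k) auto
  have "reduction_seq q (m + i) = reduction_seq q' (n + i)" for i
  proof -
    have "(gauss ^^ (i + m)) q = (gauss ^^ (i + n)) q'"
      by (simp add: funpow_add mn)
    then show ?thesis
      using mn(1) by (auto simp: reduction_seq_eq flip add.commute)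
  qed
  then show ?thesis
    unfolding simple_cycle_def
    using assms by (intro cycles_agree_if_tails_agree reduction_seq_becomes_periodic)
qed

section \<open>Equivalence of the iterates through explicit matrices\<close>

lemma det_step_mat: "det (step_mat n q) = 1"
  by (cases q) (simp add: step_mat_def mat_zpow_L mat_zpow_R det_2)

lemma det_reduction_mat: "det (reduction_mat q n) = 1"
  by (induction n) (simp_all add: det_mul det_step_mat)

lemma reduction_seq_act: "reduction_seq q n = act q (reduction_mat q n)"
  by (induction n) (simp_all add: act_mult)

lemma simple_cycle_equiv:
  assumes "f \<in> set (simple_cycle q)"
  shows "bqf_equiv f q"
  using assms unfolding simple_cycle_def periodic_part_def
  by (auto simp: reduction_seq_act[of q] bqf_equiv_act det_reduction_mat)

lemma simple_cycle_nonempty: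
  assumes "irrational_form q"
  shows "simple_cycle q \<noteq> []"
  using periodic_from_preperiod[OF reduction_seq_becomes_periodic[OF assms]]
  unfolding simple_cycle_def periodic_part_def periodic_from_def by simp

theorem theorem6p15:
  fixes D :: int
  assumes D_pos: "D > 0" and D_nonsquare: "\<not> (\<exists>n. D = n\<^sup>2)"
  shows "(\<forall>q. disc q = D \<longrightarrow>
            becomes_periodic (reduction_seq q) \<and>
            (\<forall>f \<in> set (simple_cycle q). simply_reduced f \<and> bqf_equiv f q) \<and>
            (\<forall>n. det (reduction_mat q n) = 1 \<and> reduction_seq q n = act q (reduction_mat q n))) \<and>
         (\<forall>q1 q2. disc q1 = D \<longrightarrow> disc q2 = D \<longrightarrow>
            (bqf_equiv q1 q2 \<longleftrightarrow> cycles_agree (simple_cycle q1) (simple_cycle q2)))"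
proof -
  have irr: "irrational_form q" if "disc q = D" for q
    using that D_pos D_nonsquare unfolding irrational_form_def by simp
  have "bqf_equiv q1 q2 \<longleftrightarrow> cycles_agree (simple_cycle q1) (simple_cycle q2)"
    if D: "disc q1 = D" "disc q2 = D" for q1 q2
  proof
    assume "bqf_equiv q1 q2"
    then have "merges True q2 q1"
      unfolding bqf_equiv_def using merges_act irr[OF D(2)] by blast
    then show "cycles_agree (simple_cycle q1) (simple_cycle q2)"
      using D irr by (intro cycles_agree_if_merges merges_sym[of _ q2])
  next
    assume "cycles_agree (simple_cycle q1) (simple_cycle q2)"
    \<comment> \<open>Rotation keeps the set of members, so any common member is equivalent to both
      forms.\<close>
    then have "set (simple_cycle q1) = set (simple_cycle q2)"
      unfolding cycles_agree_def by auto
    moreover obtain f where "f \<in> set (simple_cycle q1)"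
      using simple_cycle_nonempty[OF irr[OF D(1)]] by (meson list.set_sel(1))
    ultimately show "bqf_equiv q1 q2"
      using simple_cycle_equiv bqf_equiv_sym bqf_equiv_trans by blast
  qed
  then show ?thesis
    using irr reduction_seq_becomes_periodic simple_cycle_simply_reduced simple_cycle_equiv
      det_reduction_mat reduction_seq_act by blast
qed

end
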